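(* Let $G^{(s)}=G^{(s)}(\lambda,x,\boldsymbol t)=\sum_{n\ge 0}g_n(x,\boldsymbol t)\lambda^{-n}$ be a solution of the Schwarzian hierarchy. Let $q_2=q_2(x,\boldsymbol t)$ be a function satisfying $$dq_2=\omega_2:=\frac{1}{g_0}\left(dx-g_1\,dt_1-g_2\,dt_2-\cdots-g_n\,dt_n-\cdots\right),$$ i.e. $\partial_x q_2=1/g_0$ and $\partial_{t_i}q_2=-g_i/g_0$ for all $i\ge 1$, and define $\hat x=q_2(x,\boldsymbol t)$. Then $$G^{(n)}(\lambda,\hat x,\boldsymbol t):=\frac{G^{(s)}(\lambda,x,\boldsymbol t)}{g_0(x,\boldsymbol t)},$$ regarded as a function of the new independent variables $(\hat x,\boldsymbol t)$, solves the normalized hierarchy with $\hat x$ in the role of the space variable $x$.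
   Context: Let $\boldsymbol t=(t_1,t_2,\ldots)$ and $\langle U,V\rangle:=UV_x-U_xV$ (derivatives with respect to the space variable). Consider $G=G(\lambda,x,\boldsymbol t)=g_0+\frac{g_1}{\lambda}+\frac{g_2}{\lambda^2}+\cdots$, a formal power series in $\lambda^{-1}$ whose coefficients $g_n=g_n(x,\boldsymbol t)$ are smooth functions, subject to the evolution equations $$\frac{\partial G}{\partial t_i}=\langle A_i,G\rangle,\qquad i\ge 1 .$$ Normalized hierarchy: $g_0\equiv 1$ and $A_i=\lambda^i+g_1\lambda^{i-1}+\cdots+g_{i-1}\lambda+g_i$. Schwarzian hierarchy: $g_0\not\equiv\text{const}$ (with $g_0$ nowhere zero, so that $1/g_0$ makes sense) and $A_i=g_0\lambda^i+g_1\lambda^{i-1}+\cdots+g_{i-1}\lambda$. For a solution of the Schwarzian hierarchy the form $\omega_2$ is closed, so a function $q_2$ with $dq_2=\omega_2$ exists (locally). Since $\partial_x q_2=1/g_0\ne 0$, the map $(x,\boldsymbol t)\mapsto(\hat x,\boldsymbol t)$ is a (local) change of independent variables; in the normalized hierarchy for $G^{(n)}$, the derivatives $\partial/\partial t_i$ are taken at fixed $\hat x$. *)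

theory Defs
  imports "HOL-Analysis.Analysis" "HOL-Computational_Algebra.Formal_Laurent_Series"
begin

text \<open>
  A point \<open>z :: nat \<Rightarrow> real\<close> collects all independent variables: \<open>z 0\<close> is the space variable
  \<open>x\<close> and \<open>z i\<close>, for \<open>i \<ge> 1\<close>, is the time \<open>t\<^sub>i\<close>.
\<close>

type_synonym point = "nat \<Rightarrow> real"

text \<open>
  With infinitely many times, openness and continuity are understood in any finite number of
  variables at once, the remaining ones being frozen. (The product topology on the whole space
  would force every function to be almost independent of the higher times.)
  The trace of the product topology on \<open>slice N z\<close> is the Euclidean topology
  in the variables \<open>0, \<dots>, N\<close>.
\<close>

definition slice :: "nat \<Rightarrow> point \<Rightarrow> point set" where
  "slice N z = {w. \<forall>k>N. w k = z k}"

definition finitely_open :: "point set \<Rightarrow> bool" where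
  "finitely_open D \<longleftrightarrow> (\<forall>N z. openin (top_of_set (slice N z)) (D \<inter> slice N z))"

definition finitely_continuous_on :: "point set \<Rightarrow> (point \<Rightarrow> real) \<Rightarrow> bool" where
  "finitely_continuous_on D f \<longleftrightarrow> (\<forall>N z. continuous_on (D \<inter> slice N z) f)"

definition has_partial :: "(point \<Rightarrow> real) \<Rightarrow> nat \<Rightarrow> real \<Rightarrow> point \<Rightarrow> bool" where
  "has_partial f k d z \<longleftrightarrow> ((\<lambda>s. f (z(k := s))) has_real_derivative d) (at (z k))"

definition partial :: "nat \<Rightarrow> (point \<Rightarrow> real) \<Rightarrow> point \<Rightarrow> real" where
  "partial k f z = deriv (\<lambda>s. f (z(k := s))) (z k)"

text \<open>All iterated partial derivatives exist on \<open>D\<close> and are continuous.\<close>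

definition smooth_fun_on :: "point set \<Rightarrow> (point \<Rightarrow> real) \<Rightarrow> bool" where
  "smooth_fun_on D f \<longleftrightarrow>
     (\<forall>ks. finitely_continuous_on D (foldr partial ks f) \<and>
           (\<forall>k. \<forall>z\<in>D. \<exists>d. has_partial (foldr partial ks f) k d z))"

text \<open>
  Formal series in \<open>1/\<lambda>\<close> are power series, respectively Laurent series, whose indeterminate
  stands for \<open>1/\<lambda>\<close>.
\<close>

abbreviation lam :: "real fls" where
  "lam \<equiv> fls_X_inv"

text \<open>
  Coefficientwise partial derivative. \<open>Abs_fls\<close> is meaningful whenever the exponents of \<open>\<lambda>\<close>
  occurring in \<open>F\<close> are bounded above uniformly in \<open>z\<close>, as is the case for \<open>G\<close> and the \<open>A\<^sub>i\<close>.
\<close>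

definition fls_partial :: "nat \<Rightarrow> (point \<Rightarrow> real fls) \<Rightarrow> point \<Rightarrow> real fls" where
  "fls_partial k F z = Abs_fls (\<lambda>n. partial k (\<lambda>w. fls_nth (F w) n) z)"

definition bracket :: "(point \<Rightarrow> real fls) \<Rightarrow> (point \<Rightarrow> real fls) \<Rightarrow> point \<Rightarrow> real fls" where
  "bracket U V z = U z * fls_partial 0 V z - fls_partial 0 U z * V z"

definition coef :: "(point \<Rightarrow> real fps) \<Rightarrow> nat \<Rightarrow> point \<Rightarrow> real" where
  "coef G n z = fps_nth (G z) n"

definition evolves_by ::
  "point set \<Rightarrow> (nat \<Rightarrow> point \<Rightarrow> real fls) \<Rightarrow> (point \<Rightarrow> real fps) \<Rightarrow> bool" where
  "evolves_by D A G \<longleftrightarrow>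
     (\<forall>i\<ge>1. \<forall>z\<in>D. fls_partial i (\<lambda>w. fps_to_fls (G w)) z
                   = bracket (A i) (\<lambda>w. fps_to_fls (G w)) z)"

definition normalized_A :: "(point \<Rightarrow> real fps) \<Rightarrow> nat \<Rightarrow> point \<Rightarrow> real fls" where
  "normalized_A G i z = lam ^ i + (\<Sum>k=1..i. fls_const (coef G k z) * lam ^ (i - k))"

definition schwarzian_A :: "(point \<Rightarrow> real fps) \<Rightarrow> nat \<Rightarrow> point \<Rightarrow> real fls" where
  "schwarzian_A G i z = (\<Sum>k<i. fls_const (coef G k z) * lam ^ (i - k))"

definition normalized_solution :: "point set \<Rightarrow> (point \<Rightarrow> real fps) \<Rightarrow> bool" where
  "normalized_solution D G \<longleftrightarrow>
     finitely_open D \<and> (\<forall>n. smooth_fun_on D (coef G n)) \<and>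
     (\<forall>z\<in>D. coef G 0 z = 1) \<and>
     evolves_by D (normalized_A G) G"

definition schwarzian_solution :: "point set \<Rightarrow> (point \<Rightarrow> real fps) \<Rightarrow> bool" where
  "schwarzian_solution D G \<longleftrightarrow>
     finitely_open D \<and> (\<forall>n. smooth_fun_on D (coef G n)) \<and>
     \<not> coef G 0 constant_on D \<and> (\<forall>z\<in>D. coef G 0 z \<noteq> 0) \<and>
     evolves_by D (schwarzian_A G) G"

text \<open>The map \<open>(x, t) \<mapsto> (q (x, t), t)\<close>.\<close>

definition change_vars :: "(point \<Rightarrow> real) \<Rightarrow> point \<Rightarrow> point" where
  "change_vars q z = z(0 := q z)"

definition divide_by_g0 :: "(point \<Rightarrow> real fps) \<Rightarrow> point \<Rightarrow> real fps" where
  "divide_by_g0 G z = fps_const (1 / coef G 0 z) * G z"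

end

theory Submission
  imports Defs
begin

text \<open>
  Let \<open>\<psi>\<close> be a local inverse of the change of variables. The derivatives in the new
  variables are \<open>g\<^sub>0 \<partial>\<^sub>x\<close> and \<open>\<partial>\<^sub>i + g\<^sub>i \<partial>\<^sub>x\<close>, and the new
  \<open>A\<^sub>i\<close> is \<open>(A\<^sub>i + g\<^sub>i) / g\<^sub>0\<close>. Dividing both
  entries of the bracket by \<open>g\<^sub>0\<close> divides it by \<open>g\<^sub>0\<^sup>2\<close>, and the claim reduces to the
  \<open>\<lambda>\<^sup>0\<close>-coefficient of the Schwarzian equation, \<open>\<partial>\<^sub>i g\<^sub>0 = \<langle>g\<^sub>0, g\<^sub>i\<rangle>\<close>.
  The analytic part is that \<open>\<psi>\<close> is smooth in every finite set of variables: \<open>q\<close> is continuous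
  and strictly monotone in \<open>x\<close>, so \<open>\<psi>\<close> is continuous, and its partial derivatives follow from
  the differentiability of \<open>q\<close> in the plane of \<open>x\<close> and one time.
\<close>

section \<open>Calculus in finitely many variables\<close>

text \<open>Cubes rather than Euclidean balls, so that membership is checked coordinate by
  coordinate after an update \<open>z(k := s)\<close>.\<close>

definition box_at :: "nat \<Rightarrow> real \<Rightarrow> point \<Rightarrow> point set" where
  "box_at N e z = {w \<in> slice N z. \<forall>k\<le>N. \<bar>w k - z k\<bar> < e}"

lemma box_atI: "\<lbrakk>\<And>k. k > N \<Longrightarrow> w k = z k; \<And>k. k \<le> N \<Longrightarrow> \<bar>w k - z k\<bar> < e\<rbrakk> \<Longrightarrow> w \<in> box_at N e z"
  by (simp add: box_at_def slice_def)

lemma box_at_far: "w \<in> box_at N e z \<Longrightarrow> k > N \<Longrightarrow> w k = z k"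
  by (simp add: box_at_def slice_def)

lemma box_at_near: "w \<in> box_at N e z \<Longrightarrow> k \<le> N \<Longrightarrow> \<bar>w k - z k\<bar> < e"
  by (simp add: box_at_def)

lemma box_at_slice: "w \<in> box_at N e z \<Longrightarrow> w \<in> slice N z"
  by (simp add: box_at_def)

lemma box_at_mono: "d \<le> e \<Longrightarrow> w \<in> box_at N d z \<Longrightarrow> w \<in> box_at N e z"
  by (force simp: box_at_def)

lemma slice_self [simp]: "z \<in> slice N z"
  by (simp add: slice_def)

lemma slice_eq: "w \<in> slice N z \<Longrightarrow> slice N w = slice N z"
  by (auto simp: slice_def)

text \<open>A basic open set of the product topology restricts each coordinate separately. On the
  slice the coordinates above \<open>N\<close> equal those of \<open>z\<close>, so only finitely
  many restrictions matter and a common radius exists. Topological statements thus become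
  epsilon-delta statements about cubes.\<close>

lemma eventually_nhds_slice:
  "eventually P (inf (nhds z) (principal (slice N z))) \<longleftrightarrow> (\<exists>e>0. \<forall>w\<in>box_at N e z. P w)"
proof
  assume "eventually P (inf (nhds z) (principal (slice N z)))"
  then obtain T where T: "open T" "z \<in> T" "\<And>w. w \<in> T \<Longrightarrow> w \<in> slice N z \<Longrightarrow> P w"
    by (auto simp: eventually_inf_principal eventually_nhds)
  from T(1) have "openin (product_topology (\<lambda>_. euclidean) UNIV) T"
    by (simp add: open_fun_def)
  from product_topology_open_contains_basis[OF this T(2)]
  obtain X where X: "z \<in> (\<Pi>\<^sub>E i\<in>UNIV. X i)" "\<And>i. open (X i)" "(\<Pi>\<^sub>E i\<in>UNIV. X i) \<subseteq> T"
    by auto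
  have "\<exists>e>0. ball (z k) e \<subseteq> X k" for k
    using X(1,2) by (meson PiE_mem UNIV_I open_contains_ball)
  then obtain \<epsilon> where \<epsilon>: "\<And>k. \<epsilon> k > 0" "\<And>k. ball (z k) (\<epsilon> k) \<subseteq> X k" by metis
  define e where "e = Min (\<epsilon> ` {..N})"
  have e: "e > 0" "\<And>k. k \<le> N \<Longrightarrow> e \<le> \<epsilon> k" using \<epsilon>(1) by (auto simp: e_def)
  have "P w" if w: "w \<in> box_at N e z" for w
  proof (rule T(3))
    have "w k \<in> X k" for k
    proof (cases "k \<le> N")
      case True
      then have "w k \<in> ball (z k) (\<epsilon> k)"
        using box_at_near[OF w True] e(2)[OF True] by (simp add: dist_real_def)
      then show ?thesis using \<epsilon>(2) by blast
    next
      case False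
      then show ?thesis using X(1) box_at_far[OF w, of k] by (auto simp: PiE_def Pi_def)
    qed
    then show "w \<in> T" using X(3) by (auto simp: PiE_def)
  qed (use w in \<open>simp add: box_at_slice\<close>)
  then show "\<exists>e>0. \<forall>w\<in>box_at N e z. P w" using e(1) by blast
next
  assume "\<exists>e>0. \<forall>w\<in>box_at N e z. P w"
  then obtain e where e: "e > 0" "\<forall>w\<in>box_at N e z. P w" by blast
  define T where "T = (\<Pi>\<^sub>E i\<in>UNIV. if i \<le> N then ball (z i) e else UNIV)"
  have "open T" unfolding T_def
  proof (rule open_PiE)
    show "finite {i. (if i \<le> N then ball (z i) e else UNIV) \<noteq> UNIV}"
      by (rule finite_subset[of _ "{..N}"]) (auto split: if_splits)
  qed auto
  moreover have "z \<in> T" using e(1) by (auto simp: T_def)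
  moreover have "P w" if "w \<in> T" "w \<in> slice N z" for w
  proof -
    have "\<bar>w k - z k\<bar> < e" if "k \<le> N" for k
      using \<open>w \<in> T\<close> that by (auto simp: T_def PiE_def Pi_def dist_real_def abs_minus_commute split: if_splits)
    then show ?thesis using e(2) \<open>w \<in> slice N z\<close> by (auto simp: box_at_def)
  qed
  ultimately show "eventually P (inf (nhds z) (principal (slice N z)))"
    by (auto simp: eventually_inf_principal eventually_nhds)
qed

lemma finitely_open_iff:
  "finitely_open D \<longleftrightarrow> (\<forall>z\<in>D. \<forall>N. \<exists>e>0. box_at N e z \<subseteq> D)"
proof
  assume D: "finitely_open D"
  show "\<forall>z\<in>D. \<forall>N. \<exists>e>0. box_at N e z \<subseteq> D"
  proof (intro ballI allI)
    fix z N assume "z \<in> D"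
    from D obtain T where T: "open T" "D \<inter> slice N z = slice N z \<inter> T"
      unfolding finitely_open_def openin_open by blast
    then have "z \<in> T" using \<open>z \<in> D\<close> slice_self by blast
    then have "eventually (\<lambda>w. w \<in> D) (inf (nhds z) (principal (slice N z)))"
      using T by (auto simp: eventually_inf_principal eventually_nhds)
    then show "\<exists>e>0. box_at N e z \<subseteq> D" by (auto simp: eventually_nhds_slice)
  qed
next
  assume R: "\<forall>z\<in>D. \<forall>N. \<exists>e>0. box_at N e z \<subseteq> D"
  show "finitely_open D" unfolding finitely_open_def
  proof (intro allI)
    fix N z
    \<comment> \<open>A slice is the slice through each of its points, so the cube supplied at
      \<open>w\<close> lies in the slice through \<open>z\<close>.\<close>
    have "\<exists>T. open T \<and> w \<in> T \<and> T \<inter> slice N z \<subseteq> D \<inter> slice N z" if w: "w \<in> D \<inter> slice N z" for w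
    proof -
      have "eventually (\<lambda>w. w \<in> D) (inf (nhds w) (principal (slice N w)))"
        using R w unfolding eventually_nhds_slice by blast
      then show ?thesis using slice_eq[of w N z] w
        by (auto simp: eventually_inf_principal eventually_nhds)
    qed
    then show "openin (top_of_set (slice N z)) (D \<inter> slice N z)"
      by (subst openin_subopen) (meson IntE IntI Int_lower2 openin_Int_open inf.coboundedI2
          openin_open_Int order_refl inf_commute subset_iff)
  qed
qed

text \<open>Around each of its points \<open>D\<close> contains a cube in every slice, so the limit
  within \<open>D\<close> can be tested on whole cubes.\<close>

lemma finitely_continuous_on_iff:
  assumes "finitely_open D"
  shows "finitely_continuous_on D f \<longleftrightarrow>
    (\<forall>z\<in>D. \<forall>N. \<forall>e>0. \<exists>d>0. \<forall>w\<in>box_at N d z. \<bar>f w - f z\<bar> < e)"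
proof -
  have *: "(f \<longlongrightarrow> f w) (at w within D \<inter> slice N w) \<longleftrightarrow>
      (\<forall>e>0. \<exists>d>0. \<forall>w'\<in>box_at N d w. \<bar>f w' - f w\<bar> < e)" if "w \<in> D" for w N
  proof -
    have "eventually (\<lambda>w. w \<in> D) (inf (nhds w) (principal (slice N w)))"
      using assms that unfolding finitely_open_iff eventually_nhds_slice by blast
    then have ev: "eventually (\<lambda>w'. w' \<in> slice N w \<longrightarrow> w' \<in> D) (nhds w)"
      by (simp add: eventually_inf_principal)
    \<comment> \<open>The two filters differ only at points outside \<open>D\<close>, which
      \<open>ev\<close> excludes near \<open>w\<close>, and at \<open>w\<close> itself, where the
      distance is 0.\<close>
    have "eventually (\<lambda>x. dist (f x) (f w) < e) (at w within D \<inter> slice N w) \<longleftrightarrow>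
        eventually (\<lambda>x. dist (f x) (f w) < e) (inf (nhds w) (principal (slice N w)))"
      if "e > 0" for e
      unfolding at_within_def eventually_inf_principal
    proof (intro iffI)
      assume "\<forall>\<^sub>F x in nhds w. x \<in> D \<inter> slice N w - {w} \<longrightarrow> dist (f x) (f w) < e"
      with ev show "\<forall>\<^sub>F x in nhds w. x \<in> slice N w \<longrightarrow> dist (f x) (f w) < e"
        by eventually_elim (use that in auto)
    next
      assume "\<forall>\<^sub>F x in nhds w. x \<in> slice N w \<longrightarrow> dist (f x) (f w) < e"
      then show "\<forall>\<^sub>F x in nhds w. x \<in> D \<inter> slice N w - {w} \<longrightarrow> dist (f x) (f w) < e"
        by eventually_elim auto
    qed
    then show ?thesis
      unfolding tendsto_iff eventually_nhds_slice by (auto simp: dist_real_def)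
  qed
  have "finitely_continuous_on D f \<longleftrightarrow> (\<forall>w\<in>D. \<forall>N. (f \<longlongrightarrow> f w) (at w within D \<inter> slice N w))"
    unfolding finitely_continuous_on_def continuous_on_def
    using slice_eq slice_self by (metis IntD1 IntD2 IntI)
  with * show ?thesis by blast
qed

lemma box_at_subset:
  assumes "finitely_open D" "z \<in> D"
  obtains e where "e > 0" "box_at N e z \<subseteq> D"
  using assms unfolding finitely_open_iff by blast

lemma finitely_continuous_onD:
  assumes "finitely_open D" "finitely_continuous_on D f" "z \<in> D" "e > 0"
  obtains d where "d > 0" "\<And>w. w \<in> box_at N d z \<Longrightarrow> \<bar>f w - f z\<bar> < e"
  using finitely_continuous_on_iff[OF assms(1), THEN iffD1, OF assms(2), rule_format, OF assms(3,4), of N]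
    that by blast

lemma box_at_upd:
  assumes "\<bar>s - z k\<bar> < e"
  shows "z(k := s) \<in> box_at k e z"
  using assms by (intro box_atI) (auto split: if_splits)

text \<open>Makes derivatives along coordinate lines depend only on the values on \<open>D\<close>;
  elsewhere functions may be arbitrary.\<close>

lemma eventually_fun_upd_mem:
  assumes "finitely_open D" "z \<in> D"
  shows "eventually (\<lambda>s. z(k := s) \<in> D) (nhds (z k))"
proof -
  obtain e where e: "e > 0" "box_at k e z \<subseteq> D" using box_at_subset[OF assms] .
  show ?thesis unfolding eventually_nhds_metric
    using e box_at_upd[of _ z k e] by (auto simp: dist_real_def)
qed

section \<open>Partial derivatives along coordinate lines\<close>

lemma partialI: "has_partial f k d z \<Longrightarrow> partial k f z = d"
  unfolding has_partial_def partial_def by (rule DERIV_imp_deriv)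

lemma has_partial_cong:
  assumes "finitely_open D" "z \<in> D" "\<And>w. w \<in> D \<Longrightarrow> f w = g w"
  shows "has_partial f k d z \<longleftrightarrow> has_partial g k d z"
  unfolding has_partial_def
  by (intro DERIV_cong_ev refl eventually_mono[OF eventually_fun_upd_mem[OF assms(1,2)]] assms(3))

lemma partial_cong:
  assumes "finitely_open D" "z \<in> D" "\<And>w. w \<in> D \<Longrightarrow> f w = g w"
  shows "partial k f z = partial k g z"
  unfolding partial_def
  by (intro deriv_cong_ev refl eventually_mono[OF eventually_fun_upd_mem[OF assms(1,2)]] assms(3))

lemma finitely_continuous_on_subset:
  "finitely_continuous_on D f \<Longrightarrow> U \<subseteq> D \<Longrightarrow> finitely_continuous_on U f"
  unfolding finitely_continuous_on_def by (meson Int_mono continuous_on_subset order_refl)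

lemma finitely_continuous_on_cong:
  "(\<And>w. w \<in> D \<Longrightarrow> f w = g w) \<Longrightarrow> finitely_continuous_on D f \<longleftrightarrow> finitely_continuous_on D g"
  unfolding finitely_continuous_on_def by (intro iff_allI continuous_on_cong) auto

text \<open>The bound on \<open>t\<close> is symmetric and non-strict, so that \<open>s\<close> may
  lie on either side of \<open>z k\<close> or coincide with it.\<close>

lemma partial_MVT:
  assumes "\<And>t. \<bar>t - z k\<bar> \<le> \<bar>s - z k\<bar> \<Longrightarrow> has_partial f k (g (z(k := t))) (z(k := t))"
  obtains t where "\<bar>t - z k\<bar> \<le> \<bar>s - z k\<bar>" "f (z(k := s)) - f z = g (z(k := t)) * (s - z k)"
proof -
  let ?F = "\<lambda>t. f (z(k := t))" and ?G = "\<lambda>t. g (z(k := t))"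
  have D: "(?F has_real_derivative ?G t) (at t)" if "\<bar>t - z k\<bar> \<le> \<bar>s - z k\<bar>" for t
    using assms[OF that] by (simp add: has_partial_def)
  consider "s = z k" | "s < z k" | "z k < s" by linarith
  then show ?thesis
  proof cases
    case 1
    then show ?thesis using that[of s] by simp
  next
    case 2
    with MVT2[of s "z k" ?F ?G] D obtain t where "s < t" "t < z k" "?F (z k) - ?F s = (z k - s) * ?G t"
      by force
    then show ?thesis using that[of t] 2 by (simp add: algebra_simps)
  next
    case 3
    with MVT2[of "z k" s ?F ?G] D obtain t where "t < s" "z k < t" "?F s - ?F (z k) = (s - z k) * ?G t"
      by force
    then show ?thesis using that[of t] 3 by (simp add: algebra_simps)
  qed
qed

text \<open>Telescopes along the path changing one coordinate at a time.\<close>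

lemma finitely_continuous_on_partials:
  assumes D: "finitely_open D"
    and df: "\<And>k z. z \<in> D \<Longrightarrow> has_partial f k (g k z) z"
    and g: "\<And>k. finitely_continuous_on D (g k)"
  shows "finitely_continuous_on D f"
  unfolding finitely_continuous_on_iff[OF D]
proof (intro ballI allI impI)
  fix z N and e :: real assume z: "z \<in> D" and "e > 0"
  obtain r where r: "r > 0" "box_at N r z \<subseteq> D" using box_at_subset[OF D z] .
  have "\<exists>d>0. \<forall>w\<in>box_at N d z. \<bar>g k w - g k z\<bar> < 1" for k
    using g[of k] z unfolding finitely_continuous_on_iff[OF D] by simp
  then obtain \<delta> where \<delta>: "\<And>k. \<delta> k > 0" "\<And>k w. w \<in> box_at N (\<delta> k) z \<Longrightarrow> \<bar>g k w - g k z\<bar> < 1"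
    by metis
  \<comment> \<open>\<open>M\<close> sums the bounds \<open>\<bar>g k z\<bar> + 1\<close> that hold
    for the partials near \<open>z\<close>; the 1 keeps each of them positive.\<close>
  define M where "M = (\<Sum>k\<le>N. \<bar>g k z\<bar> + 1)"
  have M: "M > 0" unfolding M_def by (intro sum_pos) auto
  \<comment> \<open>\<open>r\<close> keeps the path in \<open>D\<close>, the
    \<open>\<delta> k\<close> keep the bounds on the partials valid, and \<open>e / M\<close> limits
    the total increment \<open>M * d\<close> to \<open>e\<close>.\<close>
  define d where "d = Min (insert r (insert (e / M) (\<delta> ` {..N})))"
  have d: "d > 0" "d \<le> r" "d \<le> e / M" "\<And>k. k \<le> N \<Longrightarrow> d \<le> \<delta> k"
    using r \<delta>(1) \<open>e > 0\<close> M by (auto simp: d_def min_le_iff_disj)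
  have "\<bar>f w - f z\<bar> < e" if w: "w \<in> box_at N d z" for w
  proof -
    \<comment> \<open>\<open>v j\<close> takes its first \<open>j\<close> coordinates from
      \<open>w\<close> and the rest from \<open>z\<close>; \<open>v (Suc N) = w\<close> because the
      coordinates above \<open>N\<close> agree.\<close>
    define v where "v j = (\<lambda>k. if k < j then w k else z k)" for j
    have step: "\<bar>f (v (Suc j)) - f (v j)\<bar> < (\<bar>g j z\<bar> + 1) * d" if "j \<le> N" for j
    proof -
      have wj: "\<bar>w j - z j\<bar> < d" using box_at_near[OF w that] .
      have vj: "v j j = z j" "v (Suc j) = (v j)(j := w j)" by (auto simp: v_def fun_eq_iff)
      have in_box: "(v j)(j := t) \<in> box_at N d z" if "\<bar>t - z j\<bar> \<le> \<bar>w j - z j\<bar>" for t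
        using order_le_less_trans[OF that wj] \<open>j \<le> N\<close> box_at_near[OF w] box_at_far[OF w] d(1)
        by (intro box_atI) (auto simp: v_def)
      have "has_partial f j (g j ((v j)(j := t))) ((v j)(j := t))" if "\<bar>t - v j j\<bar> \<le> \<bar>w j - v j j\<bar>" for t
        using in_box that vj(1) r(2) box_at_mono[OF d(2)] by (intro df) auto
      then obtain t where t: "\<bar>t - v j j\<bar> \<le> \<bar>w j - v j j\<bar>"
        "f ((v j)(j := w j)) - f (v j) = g j ((v j)(j := t)) * (w j - v j j)"
        by (rule partial_MVT[where z = "v j" and k = j])
      have "\<bar>g j ((v j)(j := t)) - g j z\<bar> < 1"
        using in_box[of t] t(1) vj(1) box_at_mono[OF d(4)[OF \<open>j \<le> N\<close>]] by (intro \<delta>(2)) auto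
      then have "\<bar>g j ((v j)(j := t))\<bar> \<le> \<bar>g j z\<bar> + 1" by linarith
      then have "\<bar>f (v (Suc j)) - f (v j)\<bar> \<le> (\<bar>g j z\<bar> + 1) * \<bar>w j - z j\<bar>"
        unfolding vj(2) t(2) vj(1) abs_mult by (intro mult_right_mono) auto
      also have "\<dots> < (\<bar>g j z\<bar> + 1) * d" using wj by (intro mult_strict_left_mono) auto
      finally show ?thesis .
    qed
    have "v 0 = z" "v (Suc N) = w" using box_at_far[OF w] by (auto simp: v_def fun_eq_iff not_less_eq)
    then have "f w - f z = (\<Sum>j\<le>N. f (v (Suc j)) - f (v j))"
      using sum_lessThan_telescope[of "\<lambda>j. f (v j)" "Suc N"] by (simp add: lessThan_Suc_atMost)
    also have "\<bar>\<dots>\<bar> \<le> (\<Sum>j\<le>N. \<bar>f (v (Suc j)) - f (v j)\<bar>)" by (rule sum_abs)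
    also have "\<dots> < (\<Sum>j\<le>N. (\<bar>g j z\<bar> + 1) * d)" by (rule sum_strict_mono) (auto simp: step)
    also have "\<dots> = M * d" by (simp add: M_def sum_distrib_right)
    also have "\<dots> \<le> M * (e / M)" using d(3) M by (intro mult_left_mono) auto
    finally show ?thesis using M by simp
  qed
  then show "\<exists>d>0. \<forall>w\<in>box_at N d z. \<bar>f w - f z\<bar> < e" using d(1) by blast
qed

text \<open>One partial at the point and a continuous other one around it give total
  differentiability in a plane. Two variables suffice later: the change of variables alters only
  \<open>x\<close>, and differentiation involves one time at once.\<close>

lemma has_derivative_two_partials:
  assumes D: "finitely_open D" and z: "z \<in> D" and "i \<noteq> j"
    and fi: "has_partial f i a z"
    and fj: "\<And>w. w \<in> D \<Longrightarrow> has_partial f j (g w) w"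
    and g: "finitely_continuous_on D g"
  shows "((\<lambda>(x, y). f (z(i := x, j := y))) has_derivative (\<lambda>(x, y). a * x + g z * y)) (at (z i, z j))"
proof -
  define N where "N = max i j"
  obtain r where r: "r > 0" "box_at N r z \<subseteq> D" using box_at_subset[OF D z] .
  let ?X = "{z i - r<..<z i + r}" and ?Y = "{z j - r<..<z j + r}"
  have box: "z(i := x, j := y) \<in> box_at N d z" if "\<bar>x - z i\<bar> < d" "\<bar>y - z j\<bar> < d" for x y d
    using that by (intro box_atI) (auto simp: N_def)
  \<comment> \<open>The partial derivative in \<open>y\<close> is packaged as a bounded linear map,
    since \<open>has_derivative_partialsI\<close> asks for its continuity as an operator-valued
    function.\<close>
  let ?G = "\<lambda>x y. blinfun_scaleR_left (g (z(i := x, j := y)))"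
  have "((\<lambda>(x, y). f (z(i := x, j := y))) has_derivative
      (\<lambda>(tx, ty). a * tx + blinfun_apply (?G (z i) (z j)) ty)) (at (z i, z j) within ?X \<times> ?Y)"
  proof (rule has_derivative_partialsI)
    have "z(i := x, j := z j) = z(i := x)" for x using \<open>i \<noteq> j\<close> by auto
    then show "((\<lambda>x. f (z(i := x, j := z j))) has_derivative (*) a) (at (z i) within ?X)"
      using fi unfolding has_partial_def has_field_derivative_def
      by (simp add: has_derivative_at_withinI)
  next
    fix x y assume "x \<in> ?X" "y \<in> ?Y"
    then have "z(i := x, j := y) \<in> D" using box[of x r y] r(2) by (auto simp: abs_less_iff)
    from fj[OF this] show "((\<lambda>y. f (z(i := x, j := y))) has_derivative blinfun_apply (?G x y)) (at y within ?Y)"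
      unfolding has_partial_def has_field_derivative_def
      by (auto simp: mult.commute[of _ "g _"] intro!: has_derivative_at_withinI)
  next
    have "((\<lambda>p. g (z(i := fst p, j := snd p))) \<longlongrightarrow> g z) (at (z i, z j) within ?X \<times> ?Y)"
    proof (rule tendstoI)
      fix e :: real assume "e > 0"
      obtain d where d: "d > 0" "\<And>w. w \<in> box_at N d z \<Longrightarrow> \<bar>g w - g z\<bar> < e"
        using finitely_continuous_onD[OF D g z \<open>e > 0\<close>] by blast
      show "\<forall>\<^sub>F p in at (z i, z j) within ?X \<times> ?Y. dist (g (z(i := fst p, j := snd p))) (g z) < e"
        unfolding eventually_at
      proof (intro exI[of _ d] conjI ballI impI d(1))
        fix p assume "p \<noteq> (z i, z j) \<and> dist p (z i, z j) < d"
        then have "\<bar>fst p - z i\<bar> < d" "\<bar>snd p - z j\<bar> < d"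
          using dist_fst_le[of p "(z i, z j)"] dist_snd_le[of p "(z i, z j)"]
          by (auto simp: dist_real_def)
        then show "dist (g (z(i := fst p, j := snd p))) (g z) < e"
          using d(2) box by (simp add: dist_real_def)
      qed
    qed
    then show "continuous (at (z i, z j) within ?X \<times> ?Y) (\<lambda>(x, y). ?G x y)"
      unfolding continuous_within split_beta
      by (intro bounded_linear.tendsto[OF bounded_linear_blinfun_scaleR_left]) simp
  qed (use r in auto)
  moreover have "at (z i, z j) within ?X \<times> ?Y = at (z i, z j)"
    using r(1) by (intro at_within_open open_Times) auto
  ultimately show ?thesis by (simp add: mult.commute[of _ "g _"] split_beta)
qed

section \<open>Smooth functions\<close>

text \<open>A class of continuous functions closed under all partials contains every iterated
  partial of its members, up to equality on \<open>D\<close>.\<close>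

lemma smooth_fun_on_coinduct:
  assumes D: "finitely_open D" and f: "f \<in> C"
    and cont: "\<And>f. f \<in> C \<Longrightarrow> finitely_continuous_on D f"
    and diff: "\<And>f k. f \<in> C \<Longrightarrow> \<exists>g\<in>C. \<forall>z\<in>D. has_partial f k (g z) z"
  shows "smooth_fun_on D f"
proof -
  \<comment> \<open>Equality is claimed on \<open>D\<close> only, as nothing is known about
    \<open>deriv\<close> elsewhere; \<open>partial_cong\<close> carries it through a further
    derivative because \<open>D\<close> is finitely open.\<close>
  have C: "\<exists>g\<in>C. \<forall>z\<in>D. foldr partial ks f z = g z" for ks
  proof (induction ks)
    case Nil
    show ?case using f by auto
  next
    case (Cons k ks)
    then obtain g where g: "g \<in> C" "\<And>z. z \<in> D \<Longrightarrow> foldr partial ks f z = g z" by blast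
    from diff[OF g(1)] obtain h where h: "h \<in> C" "\<And>z. z \<in> D \<Longrightarrow> has_partial g k (h z) z" by blast
    have "foldr partial (k # ks) f z = h z" if "z \<in> D" for z
      using partial_cong[OF D that g(2)] partialI[OF h(2)[OF that]] by simp
    with h(1) show ?case by blast
  qed
  show ?thesis
    unfolding smooth_fun_on_def
  proof (intro allI conjI ballI)
    fix ks
    from C obtain g where g: "g \<in> C" "\<And>z. z \<in> D \<Longrightarrow> foldr partial ks f z = g z" by blast
    show "finitely_continuous_on D (foldr partial ks f)"
      using finitely_continuous_on_cong[of D "foldr partial ks f" g, OF g(2)] cont[OF g(1)] by simp
    fix k z assume z: "z \<in> D"
    from diff[OF g(1), of k] z obtain d where "has_partial g k d z" by blast
    then show "\<exists>d. has_partial (foldr partial ks f) k d z"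
      using has_partial_cong[OF D z, of "foldr partial ks f" g, OF g(2)] by blast
  qed
qed

lemma smooth_fun_on_partial: "smooth_fun_on D f \<Longrightarrow> smooth_fun_on D (partial k f)"
  unfolding smooth_fun_on_def
proof (intro allI)
  fix ks
  assume *: "\<forall>ks. finitely_continuous_on D (foldr partial ks f) \<and>
           (\<forall>k. \<forall>z\<in>D. \<exists>d. has_partial (foldr partial ks f) k d z)"
  show "finitely_continuous_on D (foldr partial ks (partial k f)) \<and>
           (\<forall>ka. \<forall>z\<in>D. \<exists>d. has_partial (foldr partial ks (partial k f)) ka d z)"
    \<comment> \<open>\<open>foldr\<close> applies the last entry of the list first, so
      \<open>k\<close> goes to the end.\<close>
    using *[rule_format, of "ks @ [k]"] by simp
qed

lemma smooth_fun_on_imp_continuous: "smooth_fun_on D f \<Longrightarrow> finitely_continuous_on D f"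
  unfolding smooth_fun_on_def by (metis foldr.simps(1) id_apply)

lemma smooth_fun_on_has_partial: "smooth_fun_on D f \<Longrightarrow> z \<in> D \<Longrightarrow> has_partial f k (partial k f z) z"
  unfolding smooth_fun_on_def by (metis foldr.simps(1) id_apply partialI)

lemma smooth_fun_on_subset: "smooth_fun_on D f \<Longrightarrow> U \<subseteq> D \<Longrightarrow> smooth_fun_on U f"
  unfolding smooth_fun_on_def by (meson finitely_continuous_on_subset subsetD)

section \<open>Arithmetic of smooth functions\<close>

lemma has_partial_add:
  "has_partial f k a z \<Longrightarrow> has_partial g k b z \<Longrightarrow> has_partial (\<lambda>w. f w + g w) k (a + b) z"
  unfolding has_partial_def by (rule DERIV_add)

lemma has_partial_mult:
  "has_partial f k a z \<Longrightarrow> has_partial g k b z \<Longrightarrow>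
    has_partial (\<lambda>w. f w * g w) k (a * g z + b * f z) z"
  unfolding has_partial_def using DERIV_mult by fastforce

text \<open>The derivative is written with constants, products and inverses only, the form in which
  membership in \<open>smooth_closure\<close> can be derived.\<close>

lemma has_partial_inverse:
  "has_partial f k a z \<Longrightarrow> f z \<noteq> 0 \<Longrightarrow>
    has_partial (\<lambda>w. inverse (f w)) k (- 1 * a * (inverse (f z) * inverse (f z))) z"
  unfolding has_partial_def
  by (drule DERIV_inverse_fun) (auto simp: power2_eq_square algebra_simps)

lemma has_partial_const: "has_partial (\<lambda>_. c) k 0 z"
  unfolding has_partial_def by simp

text \<open>Closed under partial derivatives, hence contained in the smooth functions by coinduction.\<close>

inductive_set smooth_closure :: "point set \<Rightarrow> (point \<Rightarrow> real) set" for D where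
  base: "smooth_fun_on D f \<Longrightarrow> f \<in> smooth_closure D"
| const: "(\<lambda>_. c) \<in> smooth_closure D"
| add: "f \<in> smooth_closure D \<Longrightarrow> g \<in> smooth_closure D \<Longrightarrow> (\<lambda>z. f z + g z) \<in> smooth_closure D"
| mult: "f \<in> smooth_closure D \<Longrightarrow> g \<in> smooth_closure D \<Longrightarrow> (\<lambda>z. f z * g z) \<in> smooth_closure D"
| inv: "f \<in> smooth_closure D \<Longrightarrow> \<forall>z\<in>D. f z \<noteq> 0 \<Longrightarrow> (\<lambda>z. inverse (f z)) \<in> smooth_closure D"

lemma smooth_closure_smooth:
  assumes D: "finitely_open D" and f: "f \<in> smooth_closure D"
  shows "smooth_fun_on D f"
  using D f
proof (rule smooth_fun_on_coinduct)
  fix f assume "f \<in> smooth_closure D"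
  then show "finitely_continuous_on D f"
  proof induction
    case (base f)
    then show ?case by (rule smooth_fun_on_imp_continuous)
  qed (auto simp: finitely_continuous_on_def intro!: continuous_intros)
next
  fix f k assume "f \<in> smooth_closure D"
  then show "\<exists>g\<in>smooth_closure D. \<forall>z\<in>D. has_partial f k (g z) z"
  proof induction
    case (base f)
    then show ?case
      using smooth_fun_on_has_partial smooth_fun_on_partial smooth_closure.base by blast
  next
    case (const c)
    show ?case by (rule bexI[of _ "\<lambda>_. 0"]) (auto intro: has_partial_const smooth_closure.const)
  next
    case (add f g)
    then obtain f' g' where "f' \<in> smooth_closure D" "\<forall>z\<in>D. has_partial f k (f' z) z"
      "g' \<in> smooth_closure D" "\<forall>z\<in>D. has_partial g k (g' z) z" by blast
    then show ?case
      by (intro bexI[of _ "\<lambda>z. f' z + g' z"])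
         (auto intro!: smooth_closure.add has_partial_add)
  next
    case (mult f g)
    then obtain f' g' where "f' \<in> smooth_closure D" "\<forall>z\<in>D. has_partial f k (f' z) z"
      "g' \<in> smooth_closure D" "\<forall>z\<in>D. has_partial g k (g' z) z" by blast
    with mult.hyps show ?case
      by (intro bexI[of _ "\<lambda>z. f' z * g z + g' z * f z"])
         (auto intro!: smooth_closure.add smooth_closure.mult has_partial_mult)
  next
    case (inv f)
    then obtain f' where f': "f' \<in> smooth_closure D" "\<forall>z\<in>D. has_partial f k (f' z) z" by blast
    have "(\<lambda>z. - 1 * f' z * (inverse (f z) * inverse (f z))) \<in> smooth_closure D"
      by (intro smooth_closure.mult smooth_closure.inv smooth_closure.const f' inv.hyps)
    with f' inv.hyps show ?case
      by (intro bexI[of _ "\<lambda>z. - 1 * f' z * (inverse (f z) * inverse (f z))"] ballI has_partial_inverse)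
         auto
  qed
qed

lemma smooth_fun_on_mult:
  "finitely_open D \<Longrightarrow> smooth_fun_on D f \<Longrightarrow> smooth_fun_on D g \<Longrightarrow> smooth_fun_on D (\<lambda>z. f z * g z)"
  by (rule smooth_closure_smooth[OF _ smooth_closure.mult[OF smooth_closure.base smooth_closure.base]])

lemma smooth_fun_on_divide:
  assumes "finitely_open D" "smooth_fun_on D f" "smooth_fun_on D g" "\<And>z. z \<in> D \<Longrightarrow> g z \<noteq> 0"
  shows "smooth_fun_on D (\<lambda>z. f z / g z)"
  unfolding divide_inverse
  by (rule smooth_closure_smooth[OF assms(1) smooth_closure.mult[OF smooth_closure.base[OF assms(2)]
          smooth_closure.inv[OF smooth_closure.base[OF assms(3)]]]]) (use assms(4) in blast)

lemma smooth_fun_on_minus: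
  assumes "finitely_open D" "smooth_fun_on D f"
  shows "smooth_fun_on D (\<lambda>z. - f z)"
  using smooth_closure_smooth[OF assms(1)
      smooth_closure.mult[OF smooth_closure.const[of "-1"] smooth_closure.base[OF assms(2)]]] by simp

lemma smooth_fun_on_diff:
  assumes "finitely_open D" "smooth_fun_on D f" "smooth_fun_on D g"
  shows "smooth_fun_on D (\<lambda>z. f z - g z)"
  using smooth_closure_smooth[OF assms(1) smooth_closure.add[OF
      smooth_closure.base[OF assms(2)] smooth_closure.base[OF smooth_fun_on_minus[OF assms(1,3)]]]]
  by simp

lemma smooth_fun_on_const: "finitely_open D \<Longrightarrow> smooth_fun_on D (\<lambda>_. c)"
  by (rule smooth_closure_smooth[OF _ smooth_closure.const])

section \<open>The change of variables\<close>

text \<open>Isolates the analysis from the hierarchies: \<open>p k\<close> is the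
  \<open>k\<close>-th partial of \<open>q\<close>. Continuity of \<open>q\<close> and smoothness of
  the inverse are derived from these assumptions.\<close>

locale coordinate_change =
  fixes U :: "point set" and q :: "point \<Rightarrow> real" and p :: "nat \<Rightarrow> point \<Rightarrow> real"
  assumes open_U: "finitely_open U"
    and inj_U: "inj_on (change_vars q) U"
    and has_partial_q: "\<And>k z. z \<in> U \<Longrightarrow> has_partial q k (p k z) z"
    and smooth_p: "\<And>k. smooth_fun_on U (p k)"
    and p0_nonzero: "\<And>z. z \<in> U \<Longrightarrow> p 0 z \<noteq> 0"
begin

abbreviation "\<phi> \<equiv> change_vars q"
abbreviation "\<psi> \<equiv> inv_into U (change_vars q)"

lemma continuous_q: "finitely_continuous_on U q"
  using open_U has_partial_q smooth_fun_on_imp_continuous[OF smooth_p]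
  by (rule finitely_continuous_on_partials)

lemma continuous_on_q_line:
  assumes "\<And>s. s \<in> S \<Longrightarrow> z(0 := s) \<in> U"
  shows "continuous_on S (\<lambda>s. q (z(0 := s)))"
proof (rule DERIV_continuous_on)
  fix s assume "s \<in> S"
  from has_partial_q[OF assms[OF this], of 0]
  show "((\<lambda>s. q (z(0 := s))) has_field_derivative p 0 (z(0 := s))) (at s within S)"
    by (simp add: has_partial_def has_field_derivative_at_within)
qed

text \<open>Gives openness of the image and continuity of \<open>\<psi>\<close> together. On a short
  segment in direction \<open>x\<close> the function \<open>q\<close> is continuous and injective,
  so its values at the two ends lie strictly on opposite sides of \<open>q v\<close>. This persists
  for nearby times, and the intermediate value theorem yields the preimage.\<close>

lemma psi_box_at:
  assumes v: "v \<in> U" and "e > 0"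
  obtains d where "d > 0" "\<And>w. w \<in> box_at N d (\<phi> v) \<Longrightarrow> w \<in> \<phi> ` U \<and> \<psi> w \<in> box_at N e v"
proof -
  obtain r where r: "r > 0" "box_at N r v \<subseteq> U" using box_at_subset[OF open_U v] .
  \<comment> \<open>Half the minimum, so that the closed segment stays strictly inside both
    cubes.\<close>
  define a where "a = min e r / 2"
  have a: "a > 0" "a < e" "a < r" using \<open>e > 0\<close> r(1) by (auto simp: a_def min_def)
  have line: "v(0 := s) \<in> U" if "s \<in> {v 0 - a..v 0 + a}" for s
  proof -
    have "v(0 := s) \<in> box_at N r v" using that a r(1) by (intro box_atI) auto
    then show ?thesis using r(2) by blast
  qed
  let ?F = "\<lambda>s. q (v(0 := s))"
  have "inj_on ?F {v 0 - a..v 0 + a}"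
  proof (rule inj_onI)
    fix s t assume st: "s \<in> {v 0 - a..v 0 + a}" "t \<in> {v 0 - a..v 0 + a}" "?F s = ?F t"
    then have "\<phi> (v(0 := s)) = \<phi> (v(0 := t))" by (simp add: change_vars_def)
    then have "v(0 := s) = v(0 := t)" using inj_onD[OF inj_U] line st by blast
    then show "s = t" by (metis fun_upd_same)
  qed
  then have mono: "(?F (v 0 - a) < q v \<and> q v < ?F (v 0 + a)) \<or> (?F (v 0 + a) < q v \<and> q v < ?F (v 0 - a))"
    using continuous_inj_imp_mono[of "v 0 - a" "v 0" "v 0 + a" ?F, OF _ _ continuous_on_q_line[OF line]] a(1)
    by simp
  \<comment> \<open>Half the smaller gap: an error below \<open>\<eta>\<close> at an end and another
    in the target \<open>w 0\<close> still leave \<open>w 0\<close> between the end values.\<close>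
  define \<eta> where "\<eta> = min \<bar>?F (v 0 - a) - q v\<bar> \<bar>?F (v 0 + a) - q v\<bar> / 2"
  have \<eta>: "\<eta> > 0" using mono by (auto simp: \<eta>_def)
  obtain d1 where d1: "d1 > 0" "\<And>w. w \<in> box_at N d1 (v(0 := v 0 - a)) \<Longrightarrow> \<bar>q w - ?F (v 0 - a)\<bar> < \<eta>"
    using finitely_continuous_onD[OF open_U continuous_q line \<eta>, of "v 0 - a" N] a(1) by auto
  obtain d2 where d2: "d2 > 0" "\<And>w. w \<in> box_at N d2 (v(0 := v 0 + a)) \<Longrightarrow> \<bar>q w - ?F (v 0 + a)\<bar> < \<eta>"
    using finitely_continuous_onD[OF open_U continuous_q line \<eta>, of "v 0 + a" N] a(1) by auto
  define d where "d = min (min d1 d2) (min a \<eta>)"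
  have d: "d > 0" "d \<le> d1" "d \<le> d2" "d \<le> a" "d \<le> \<eta>"
    using d1(1) d2(1) a(1) \<eta> by (auto simp: d_def)
  have "w \<in> \<phi> ` U \<and> \<psi> w \<in> box_at N e v" if w: "w \<in> box_at N d (\<phi> v)" for w
  proof -
    have w0: "\<bar>w 0 - q v\<bar> < \<eta>" using box_at_near[OF w, of 0] d(5) by (simp add: change_vars_def)
    have wk: "\<bar>w k - v k\<bar> < d" if "k \<noteq> 0" "k \<le> N" for k
      using box_at_near[OF w that(2)] that(1) by (simp add: change_vars_def)
    have wN: "w k = v k" if "k > N" for k
      using box_at_far[OF w that] that by (simp add: change_vars_def)
    let ?H = "\<lambda>s. q (w(0 := s))"
    have in_box: "w(0 := s) \<in> box_at N c v" if "\<bar>s - v 0\<bar> \<le> a" "a < c" for s c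
      using that wN order_less_trans[OF order_less_le_trans[OF wk d(4)] that(2)] by (intro box_atI) auto
    have "w(0 := v 0 - a) \<in> box_at N d1 (v(0 := v 0 - a))"
      using order_less_le_trans[OF wk d(2)] wN d1(1) by (intro box_atI) auto
    then have H1: "\<bar>?H (v 0 - a) - ?F (v 0 - a)\<bar> < \<eta>" by (rule d1(2))
    have "w(0 := v 0 + a) \<in> box_at N d2 (v(0 := v 0 + a))"
      using order_less_le_trans[OF wk d(3)] wN d2(1) by (intro box_atI) auto
    then have H2: "\<bar>?H (v 0 + a) - ?F (v 0 + a)\<bar> < \<eta>" by (rule d2(2))
    have cont: "continuous_on {v 0 - a..v 0 + a} ?H"
      using in_box[of _ r] a(3) r(2) by (intro continuous_on_q_line) (auto simp: abs_le_iff subset_iff)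
    have \<eta>2: "2 * \<eta> \<le> \<bar>?F (v 0 - a) - q v\<bar>" "2 * \<eta> \<le> \<bar>?F (v 0 + a) - q v\<bar>" by (auto simp: \<eta>_def)
    have "\<exists>s. v 0 - a \<le> s \<and> s \<le> v 0 + a \<and> ?H s = w 0"
      using mono
    proof
      assume m: "?F (v 0 - a) < q v \<and> q v < ?F (v 0 + a)"
      show ?thesis
        by (rule IVT'[OF _ _ _ cont]) (use m \<eta>2 H1 H2 w0 a(1) in linarith)+
    next
      assume m: "?F (v 0 + a) < q v \<and> q v < ?F (v 0 - a)"
      show ?thesis
        by (rule IVT2'[OF _ _ _ cont]) (use m \<eta>2 H1 H2 w0 a(1) in linarith)+
    qed
    then obtain s where s: "\<bar>s - v 0\<bar> \<le> a" "?H s = w 0"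
      by (metis abs_diff_le_iff)
    have u: "w(0 := s) \<in> U" using in_box[OF s(1) a(3)] r(2) by blast
    have eq: "\<phi> (w(0 := s)) = w" using s(2) by (simp add: change_vars_def)
    then have "\<psi> w = w(0 := s)" using inv_into_f_f[OF inj_U u] by simp
    then show ?thesis using in_box[OF s(1) a(2)] u eq by force
  qed
  with d(1) show ?thesis by (rule that)
qed

lemma psi_phi: "v \<in> U \<Longrightarrow> \<psi> (\<phi> v) = v"
  by (rule inv_into_f_f[OF inj_U])

lemma open_image: "finitely_open (\<phi> ` U)"
  unfolding finitely_open_iff
proof safe
  fix v N assume "v \<in> U"
  obtain d where "d > 0" "\<And>w. w \<in> box_at N d (\<phi> v) \<Longrightarrow> w \<in> \<phi> ` U \<and> \<psi> w \<in> box_at N 1 v"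
    using psi_box_at[OF \<open>v \<in> U\<close> zero_less_one] by blast
  then show "\<exists>e>0. box_at N e (\<phi> v) \<subseteq> \<phi> ` U" by blast
qed

lemma continuous_compose_psi:
  assumes "finitely_continuous_on U f"
  shows "finitely_continuous_on (\<phi> ` U) (\<lambda>w. f (\<psi> w))"
  unfolding finitely_continuous_on_iff[OF open_image]
proof safe
  fix v N and e :: real assume v: "v \<in> U" and "e > 0"
  obtain d where d: "d > 0" "\<And>w. w \<in> box_at N d v \<Longrightarrow> \<bar>f w - f v\<bar> < e"
    using finitely_continuous_onD[OF open_U assms v \<open>e > 0\<close>] by blast
  obtain d' where "d' > 0" "\<And>w. w \<in> box_at N d' (\<phi> v) \<Longrightarrow> w \<in> \<phi> ` U \<and> \<psi> w \<in> box_at N d v"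
    using psi_box_at[OF v d(1)] by blast
  with d(2) show "\<exists>d>0. \<forall>w\<in>box_at N d (\<phi> v). \<bar>f (\<psi> w) - f (\<psi> (\<phi> v))\<bar> < e"
    by (auto simp: psi_phi[OF v] intro!: exI[of _ d'])
qed

text \<open>The pair \<open>(q, t\<^sub>i)\<close> is a plane map of the variables \<open>(x, t\<^sub>i)\<close>, and \<open>\<psi>\<close> provides its local
  inverse; the inverse function theorem for a given continuous inverse applies.\<close>

lemma has_derivative_compose_psi:
  assumes v: "v \<in> U" and i: "i \<noteq> 0"
    and f0: "has_partial f 0 a v"
    and fi: "\<And>z. z \<in> U \<Longrightarrow> has_partial f i (b z) z"
    and b: "finitely_continuous_on U b"
  shows "((\<lambda>(x, y). f (\<psi> ((\<phi> v)(0 := x, i := y)))) has_derivative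
    (\<lambda>(x, y). a * ((x - p i v * y) / p 0 v) + b v * y)) (at (q v, v i))"
proof -
  let ?Q = "\<lambda>(x, y). (q (v(0 := x, i := y)), y)"
  let ?g = "\<lambda>(x, y). (\<psi> ((\<phi> v)(0 := x, i := y)) 0, y)"
  \<comment> \<open>The inverse of the triangular Jacobian of \<open>?Q\<close>, whose rows are
    \<open>(p 0 v, p i v)\<close> and \<open>(0, 1)\<close>.\<close>
  let ?g' = "\<lambda>(x, y). ((x - p i v * y) / p 0 v, y)"
  have box: "(\<phi> v)(0 := x, i := y) \<in> box_at i d (\<phi> v)" if "\<bar>x - q v\<bar> < d" "\<bar>y - v i\<bar> < d" for x y d
    using that i by (intro box_atI) (auto simp: change_vars_def)
  obtain d where d: "d > 0" "\<And>w. w \<in> box_at i d (\<phi> v) \<Longrightarrow> w \<in> \<phi> ` U \<and> \<psi> w \<in> box_at i 1 v"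
    using psi_box_at[OF v zero_less_one] by blast
  define T where "T = {q v - d<..<q v + d} \<times> {v i - d<..<v i + d}"
  have T: "open T" "(q v, v i) \<in> T" using d(1) by (auto simp: T_def open_Times)
  \<comment> \<open>\<open>\<phi>\<close> alters coordinate 0 only, so the preimage differs from
    \<open>v\<close> at most in the coordinates 0 and \<open>i\<close>.\<close>
  have psi_eq: "\<psi> ((\<phi> v)(0 := x, i := y)) = v(0 := fst (?g (x, y)), i := y)"
    "fst (?Q (?g (x, y))) = x" if "(x, y) \<in> T" for x y
  proof -
    let ?w = "(\<phi> v)(0 := x, i := y)"
    have "?w \<in> \<phi> ` U" using d(2) box that by (auto simp: T_def abs_less_iff)
    then have w: "\<phi> (\<psi> ?w) = ?w" by (rule f_inv_into_f)
    then have *: "(\<psi> ?w)(0 := q (\<psi> ?w)) = ?w" by (simp add: change_vars_def)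
    have "\<psi> ?w k = (v(0 := fst (?g (x, y)), i := y)) k" for k
      using fun_cong[OF *, of k] i by (auto simp: change_vars_def split: if_splits)
    then show eq: "\<psi> ?w = v(0 := fst (?g (x, y)), i := y)" by blast
    have "fst (?Q (?g (x, y))) = q (v(0 := fst (?g (x, y)), i := y))" by simp
    also have "\<dots> = q (\<psi> ?w)" by (rule arg_cong[OF eq, symmetric])
    also have "\<dots> = x" using fun_cong[OF *, of 0] i by simp
    finally show "fst (?Q (?g (x, y))) = x" .
  qed
  have g0: "?g (q v, v i) = (v 0, v i)"
  proof -
    have "(\<phi> v)(0 := q v, i := v i) = \<phi> v" using i by (auto simp: change_vars_def)
    then show ?thesis by (simp add: psi_phi[OF v])
  qed
  have Q: "(?Q has_derivative (\<lambda>(x, y). (p 0 v * x + p i v * y, y))) (at (v 0, v i))"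
    using has_derivative_two_partials[OF open_U v i[symmetric] has_partial_q[OF v] has_partial_q
        smooth_fun_on_imp_continuous[OF smooth_p]]
    unfolding split_beta by (intro has_derivative_Pair has_derivative_snd has_derivative_ident)
  have cont: "continuous (at (q v, v i)) ?g"
    unfolding continuous_within split_beta
  proof (rule tendsto_Pair)
    show "((\<lambda>z. \<psi> ((\<phi> v)(0 := fst z, i := snd z)) 0) \<longlongrightarrow>
        \<psi> ((\<phi> v)(0 := fst (q v, v i), i := snd (q v, v i))) 0) (at (q v, v i))"
    proof (rule tendstoI)
      fix e :: real assume "e > 0"
      obtain c where c: "c > 0" "\<And>w. w \<in> box_at i c (\<phi> v) \<Longrightarrow> w \<in> \<phi> ` U \<and> \<psi> w \<in> box_at i e v"
        using psi_box_at[OF v \<open>e > 0\<close>] by blast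
      show "\<forall>\<^sub>F z in at (q v, v i). dist (\<psi> ((\<phi> v)(0 := fst z, i := snd z)) 0)
          (\<psi> ((\<phi> v)(0 := fst (q v, v i), i := snd (q v, v i))) 0) < e"
        unfolding eventually_at
      proof (intro exI[of _ c] conjI ballI impI c(1))
        fix z assume "z \<noteq> (q v, v i) \<and> dist z (q v, v i) < c"
        then have "\<bar>fst z - q v\<bar> < c" "\<bar>snd z - v i\<bar> < c"
          using dist_fst_le[of z "(q v, v i)"] dist_snd_le[of z "(q v, v i)"]
          by (auto simp: dist_real_def)
        then have "\<psi> ((\<phi> v)(0 := fst z, i := snd z)) \<in> box_at i e v" using c(2) box by blast
        from box_at_near[OF this, of 0] g0
        show "dist (\<psi> ((\<phi> v)(0 := fst z, i := snd z)) 0)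
            (\<psi> ((\<phi> v)(0 := fst (q v, v i), i := snd (q v, v i))) 0) < e"
          by (simp add: dist_real_def)
      qed
    qed
  qed (intro tendsto_intros)
  have "(?g has_derivative ?g') (at (q v, v i))"
  proof (rule has_derivative_inverse_basic[OF _ _ _ cont T])
    show "(?Q has_derivative (\<lambda>(x, y). (p 0 v * x + p i v * y, y))) (at (?g (q v, v i)))"
      using Q unfolding g0 .
    show "bounded_linear ?g'"
      unfolding split_beta divide_inverse
      by (intro bounded_linear_Pair bounded_linear_snd bounded_linear_mult_const bounded_linear_sub
          bounded_linear_fst bounded_linear_const_mult)
    show "?g' \<circ> (\<lambda>(x, y). (p 0 v * x + p i v * y, y)) = id"
      using p0_nonzero[OF v] by (auto simp: fun_eq_iff)
    show "?Q (?g z) = z" if "z \<in> T" for z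
      using psi_eq(2)[of "fst z" "snd z"] that by (cases z) (simp add: split_beta)
  qed
  moreover have "((\<lambda>(x, y). f (v(0 := x, i := y))) has_derivative (\<lambda>(x, y). a * x + b v * y)) (at (?g (q v, v i)))"
    unfolding g0 using has_derivative_two_partials[OF open_U v i[symmetric] f0 fi b] .
  ultimately have "((\<lambda>(x, y). f (v(0 := x, i := y))) \<circ> ?g has_derivative
      (\<lambda>(x, y). a * x + b v * y) \<circ> ?g') (at (q v, v i))"
    by (rule diff_chain_at)
  then have "((\<lambda>(x, y). f (\<psi> ((\<phi> v)(0 := x, i := y)))) has_derivative
      (\<lambda>(x, y). a * x + b v * y) \<circ> ?g') (at (q v, v i))"
  proof (rule has_derivative_transform_within_open[OF _ T])
    fix z assume "z \<in> T"
    then have "\<psi> ((\<phi> v)(0 := fst z, i := snd z)) = v(0 := fst (?g z), i := snd z)"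
      using psi_eq(1)[of "fst z" "snd z"] by (simp only: prod.collapse)
    from arg_cong[OF this, of f]
    show "((\<lambda>(x, y). f (v(0 := x, i := y))) \<circ> ?g) z = (\<lambda>(x, y). f (\<psi> ((\<phi> v)(0 := x, i := y)))) z"
      unfolding split_beta o_def fst_conv snd_conv by (rule sym)
  qed
  then show ?thesis by (simp only: o_def case_prod_unfold fst_conv snd_conv)
qed

text \<open>The plane derivative is restricted to its coordinate lines. For a time, the correction
  term arises because keeping \<open>q\<close> fixed forces \<open>x\<close> to move at rate
  \<open>- p k / p 0\<close>.\<close>

lemma has_partial_compose_psi:
  assumes v: "v \<in> U"
    and f: "\<And>z k. z \<in> U \<Longrightarrow> has_partial f k (g k z) z"
    and g: "\<And>k. finitely_continuous_on U (g k)"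
  shows "has_partial (\<lambda>w. f (\<psi> w)) k
    (if k = 0 then g 0 v / p 0 v else g k v - g 0 v * p k v / p 0 v) (\<phi> v)"
proof -
  have H: "((\<lambda>(x, y). f (\<psi> ((\<phi> v)(0 := x, i := y)))) has_derivative
      (\<lambda>(x, y). g 0 v * ((x - p i v * y) / p 0 v) + g i v * y)) (at (q v, v i))" if "i \<noteq> 0" for i
    using has_derivative_compose_psi[OF v that f[OF v] f g] .
  have \<phi>0: "\<phi> v 0 = q v" and \<phi>i: "i \<noteq> 0 \<Longrightarrow> \<phi> v i = v i" for i by (auto simp: change_vars_def)
  show ?thesis
  proof (cases "k = 0")
    case True
    \<comment> \<open>The plane needs some time as its second variable; the first one serves, frozen
      at \<open>v 1\<close>.\<close>
    have "((\<lambda>s. (s, v 1)) has_derivative (\<lambda>s. (s, 0))) (at (q v))"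
      by (intro derivative_intros)
    from diff_chain_at[OF this H[of 1]]
    have "((\<lambda>s. f (\<psi> ((\<phi> v)(0 := s, 1 := v 1)))) has_derivative (\<lambda>s. g 0 v / p 0 v * s)) (at (q v))"
      by (simp add: o_def)
    moreover have "(\<phi> v)(0 := s, 1 := v 1) = (\<phi> v)(0 := s)" for s by (auto simp: change_vars_def)
    ultimately show ?thesis
      unfolding True has_partial_def has_field_derivative_def \<phi>0 by (simp only: if_True simp_thms)
  next
    case False
    have "((\<lambda>s. (q v, s)) has_derivative (\<lambda>s. (0, s))) (at (v k))"
      by (intro derivative_intros)
    from diff_chain_at[OF this H[OF False]]
    have "((\<lambda>s. f (\<psi> ((\<phi> v)(0 := q v, k := s)))) has_derivative
        (\<lambda>s. (g k v - g 0 v * p k v / p 0 v) * s)) (at (v k))"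
      by (simp add: o_def algebra_simps)
    moreover have "(\<phi> v)(0 := q v, k := s) = (\<phi> v)(k := s)" for s using False by (auto simp: change_vars_def)
    ultimately show ?thesis
      using False unfolding has_partial_def has_field_derivative_def \<phi>i[OF False]
      by (simp only: if_False simp_thms)
  qed
qed

text \<open>By the chain rule a partial of such a composition is again a smooth function of the old
  variables composed with \<open>\<psi>\<close>, so these compositions form a class fit for
  coinduction.\<close>

lemma smooth_compose_psi:
  assumes "smooth_fun_on U f"
  shows "smooth_fun_on (\<phi> ` U) (\<lambda>w. f (\<psi> w))"
proof (rule smooth_fun_on_coinduct[OF open_image, where C = "{\<lambda>w. f (\<psi> w) |f. smooth_fun_on U f}"])
  show "(\<lambda>w. f (\<psi> w)) \<in> {\<lambda>w. f (\<psi> w) |f. smooth_fun_on U f}" using assms by blast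
next
  fix h assume "h \<in> {\<lambda>w. f (\<psi> w) |f. smooth_fun_on U f}"
  then show "finitely_continuous_on (\<phi> ` U) h"
    using continuous_compose_psi smooth_fun_on_imp_continuous by blast
next
  fix h k assume "h \<in> {\<lambda>w. f (\<psi> w) |f. smooth_fun_on U f}"
  then obtain f where f: "smooth_fun_on U f" "h = (\<lambda>w. f (\<psi> w))" by blast
  let ?g = "\<lambda>v. if k = 0 then partial 0 f v / p 0 v else partial k f v - partial 0 f v * p k v / p 0 v"
  have "smooth_fun_on U ?g"
    using f(1) smooth_p open_U p0_nonzero
    by (cases "k = 0")
       (auto intro!: smooth_fun_on_divide smooth_fun_on_diff smooth_fun_on_mult smooth_fun_on_partial)
  moreover have "has_partial h k (?g (\<psi> w)) w" if "w \<in> \<phi> ` U" for w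
  proof -
    from that obtain v where v: "v \<in> U" "w = \<phi> v" by blast
    show ?thesis
      using has_partial_compose_psi[OF v(1) smooth_fun_on_has_partial[OF f(1)]
          smooth_fun_on_imp_continuous[OF smooth_fun_on_partial[OF f(1)]], of k]
      unfolding f(2) v(2) psi_phi[OF v(1)] .
  qed
  ultimately show "\<exists>g\<in>{\<lambda>w. f (\<psi> w) |f. smooth_fun_on U f}. \<forall>z\<in>\<phi> ` U. has_partial h k (g z) z"
    by (intro bexI[of _ "\<lambda>w. ?g (\<psi> w)"] ballI CollectI exI[of _ ?g] conjI refl)
qed

end

section \<open>The evolution equations\<close>

text \<open>The common shape of both families \<open>A\<^sub>i\<close>, indexed from the top power
  of \<open>\<lambda>\<close> downwards to match the numbering of the
  \<open>g\<^sub>k\<close>.\<close>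

definition lam_poly :: "(nat \<Rightarrow> real) \<Rightarrow> nat \<Rightarrow> real fls" where
  "lam_poly c i = (\<Sum>k\<le>i. fls_const (c k) * lam ^ (i - k))"

lemma lam_poly_last: "lam_poly c i = (\<Sum>k<i. fls_const (c k) * lam ^ (i - k)) + fls_const (c i)"
  unfolding lam_poly_def lessThan_Suc_atMost[symmetric] by simp

lemma lam_poly_cong: "(\<And>k. k \<le> i \<Longrightarrow> c k = d k) \<Longrightarrow> lam_poly c i = lam_poly d i"
  by (simp add: lam_poly_def)

lemma lam_poly_scale: "lam_poly (\<lambda>k. x * c k) i = fls_const x * lam_poly c i"
  by (simp add: lam_poly_def sum_distrib_left mult.assoc flip: fls_const_mult_const)

lemma lam_poly_diff: "lam_poly (\<lambda>k. c k - d k) i = lam_poly c i - lam_poly d i"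
  by (simp add: lam_poly_def sum_subtractf left_diff_distrib flip: fls_minus_const)

text \<open>The indeterminate is \<open>1/\<lambda>\<close>, so \<open>lam ^ (i - k)\<close> sits at
  exponent \<open>k - i\<close>.\<close>

lemma lam_poly_nth:
  "fls_nth (lam_poly c i) n = (if - int i \<le> n \<and> n \<le> 0 then c (nat (n + int i)) else 0)"
proof -
  have "fls_nth (lam_poly c i) n = (\<Sum>k\<le>i. if k = nat (n + int i) \<and> - int i \<le> n \<and> n \<le> 0 then c k else 0)"
    unfolding lam_poly_def fls_nth_sum by (intro sum.cong) (auto simp: fls_X_inv_power_times_conv_shift)
  also have "\<dots> = (if - int i \<le> n \<and> n \<le> 0 then c (nat (n + int i)) else 0)"
    by (cases "- int i \<le> n \<and> n \<le> 0") auto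
  finally show ?thesis .
qed

lemma partial_const [simp]: "partial k (\<lambda>_. c) z = 0"
  by (rule partialI[OF has_partial_const])

text \<open>The exponents are at least \<open>- int i\<close> uniformly in the point, which makes
  \<open>Abs_fls\<close> meaningful.\<close>

lemma fls_partial_lam_poly:
  "fls_partial k (\<lambda>w. lam_poly (c w) i) z = lam_poly (\<lambda>j. partial k (\<lambda>w. c w j) z) i"
  unfolding fls_partial_def
  by (intro fls_eqI, subst nth_Abs_fls_lower_bound[of "- int i"]) (auto simp: lam_poly_nth)

lemma fls_partial_fps_to_fls:
  "fls_partial k (\<lambda>w. fps_to_fls (G w)) z = fps_to_fls (Abs_fps (\<lambda>n. partial k (coef G n) z))"
  unfolding fls_partial_def
  by (intro fls_eqI, subst nth_Abs_fls_lower_bound[of 0]) (auto simp: coef_def[abs_def])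

text \<open>\<open>lam ^ (i - k)\<close> is cancelled exactly by the term of index
  \<open>i - k\<close> of \<open>F\<close>.\<close>

lemma lam_poly_times_fps_nth_0:
  "fls_nth (lam_poly c i * fps_to_fls F) 0 = (\<Sum>k\<le>i. c k * fps_nth F (i - k))"
proof -
  have "fls_nth (fls_const x * lam ^ m * fps_to_fls F) 0 = x * fps_nth F m" for x m
    unfolding mult.assoc fls_X_inv_power_times_conv_shift(1) by simp
  then show ?thesis
    unfolding lam_poly_def sum_distrib_right fls_nth_sum by simp
qed

lemma schwarzian_A_eq:
  "schwarzian_A G i z = lam_poly (\<lambda>k. if k < i then coef G k z else 0) i"
  by (simp add: schwarzian_A_def lam_poly_last)

lemma normalized_A_eq:
  "normalized_A G i z = lam_poly (\<lambda>k. if k = 0 then 1 else coef G k z) i"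
proof -
  have "{..i} = insert 0 {1..i}" by auto
  then show ?thesis by (simp add: normalized_A_def lam_poly_def)
qed

text \<open>Reflecting \<open>k\<close> to \<open>i - k\<close> exchanges the two halves of the
  summand.\<close>

lemma sum_antisymmetric_eq_0:
  fixes f g :: "nat \<Rightarrow> real"
  shows "(\<Sum>k\<le>i. f k * g (i - k) - g k * f (i - k)) = 0"
proof -
  have "(\<Sum>k\<le>i. f k * g (i - k)) = (\<Sum>k\<le>i. g k * f (i - k))"
    by (subst sum.nat_diff_reindex[symmetric, of _ "Suc i", unfolded lessThan_Suc_atMost])
       (auto intro!: sum.cong simp: mult.commute)
  then show ?thesis by (simp add: sum_subtractf)
qed

text \<open>The terms with \<open>0 < k < i\<close> of the constant coefficient of \<open>\<langle>A\<^sub>i, G\<rangle>\<close> cancel by antisymmetry.\<close>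

lemma schwarzian_g0_evolution:
  assumes ev: "fls_partial i (\<lambda>w. fps_to_fls (G w)) z = bracket (schwarzian_A G i) (\<lambda>w. fps_to_fls (G w)) z"
  shows "partial i (coef G 0) z = coef G 0 z * partial 0 (coef G i) z - partial 0 (coef G 0) z * coef G i z"
proof -
  let ?g = "\<lambda>k. coef G k z" and ?g' = "\<lambda>k. partial 0 (coef G k) z"
  have p_if: "partial 0 (\<lambda>w. if k < i then coef G k w else 0) z = (if k < i then ?g' k else 0)" for k
    by (cases "k < i") (auto simp: eta_contract_eq)
  have "partial i (coef G 0) z = fls_nth (fls_partial i (\<lambda>w. fps_to_fls (G w)) z) 0"
    by (simp add: fls_partial_fps_to_fls)
  also have "\<dots> = fls_nth (bracket (schwarzian_A G i) (\<lambda>w. fps_to_fls (G w)) z) 0"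
    by (simp only: ev)
  also have "\<dots> = (\<Sum>k\<le>i. (if k < i then ?g k else 0) * ?g' (i - k))
      - (\<Sum>k\<le>i. (if k < i then ?g' k else 0) * ?g (i - k))"
    unfolding bracket_def fls_minus_nth fls_partial_fps_to_fls schwarzian_A_eq[abs_def]
      fls_partial_lam_poly lam_poly_times_fps_nth_0 p_if
    by (simp add: coef_def)
  also have "\<dots> = (\<Sum>k<i. ?g k * ?g' (i - k) - ?g' k * ?g (i - k))"
    by (simp add: sum_subtractf flip: lessThan_Suc_atMost)
  \<comment> \<open>Adding the missing term \<open>k = i\<close> completes an antisymmetric sum,
    which vanishes; only the subtracted term survives.\<close>
  also have "\<dots> = (\<Sum>k\<le>i. ?g k * ?g' (i - k) - ?g' k * ?g (i - k)) - (?g i * ?g' 0 - ?g' i * ?g 0)"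
    by (simp flip: lessThan_Suc_atMost)
  also have "\<dots> = ?g 0 * ?g' i - ?g' 0 * ?g i"
    by (subst sum_antisymmetric_eq_0) (simp add: mult.commute)
  finally show ?thesis .
qed

section \<open>The transformed series in the new variables\<close>

lemma coef_divide_by_g0: "coef (\<lambda>w. divide_by_g0 G (f w)) n w = coef G n (f w) / coef G 0 (f w)"
  by (simp add: coef_def divide_by_g0_def)

lemma has_partial_divide:
  assumes "has_partial f k a z" "has_partial g k b z" "g z \<noteq> 0"
  shows "has_partial (\<lambda>w. f w / g w) k ((a * g z - f z * b) / (g z)\<^sup>2) z"
  using DERIV_divide assms unfolding has_partial_def by (fastforce simp: power2_eq_square)

text \<open>The evolution equations are checked at points \<open>\<phi> v\<close> and expressed
  through the old data at \<open>v\<close>, where the Schwarzian equations reduce them to an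
  identity in a commutative ring.\<close>

lemma normalized_solution_change_vars:
  assumes S: "schwarzian_solution D G"
    and q0: "\<And>z. z \<in> D \<Longrightarrow> has_partial q 0 (1 / coef G 0 z) z"
    and qi: "\<And>i z. i \<ge> 1 \<Longrightarrow> z \<in> D \<Longrightarrow> has_partial q i (- coef G i z / coef G 0 z) z"
    and U: "U \<subseteq> D" "finitely_open U" "inj_on (change_vars q) U"
  shows "normalized_solution (change_vars q ` U) (\<lambda>w. divide_by_g0 G (inv_into U (change_vars q) w))"
proof -
  have smooth: "smooth_fun_on U (coef G n)" for n
    using S smooth_fun_on_subset[OF _ U(1)] by (simp add: schwarzian_solution_def)
  have nz: "coef G 0 z \<noteq> 0" if "z \<in> U" for z
    using S U(1) that by (auto simp: schwarzian_solution_def)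
  define p where "p k z = (if k = 0 then 1 / coef G 0 z else - coef G k z / coef G 0 z)" for k z
  interpret coordinate_change U q p
  proof
    show "has_partial q k (p k z) z" if "z \<in> U" for k z
      using q0 qi[of k] that U(1) by (auto simp: p_def)
    show "smooth_fun_on U (p k)" for k
      unfolding p_def using nz
      by (cases "k = 0") (auto intro!: smooth_fun_on_divide smooth_fun_on_minus smooth_fun_on_const smooth U(2))
    show "p 0 z \<noteq> 0" if "z \<in> U" for z using nz[OF that] by (simp add: p_def)
  qed (use U in auto)
  let ?G = "\<lambda>w. divide_by_g0 G (\<psi> w)"
  let ?h = "\<lambda>n z. coef G n z / coef G 0 z"
  have coef_G: "coef ?G n = (\<lambda>w. ?h n (\<psi> w))" for n
    by (simp add: coef_divide_by_g0 fun_eq_iff)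
  have smooth_h: "smooth_fun_on U (?h n)" for n
    by (intro smooth_fun_on_divide smooth nz U(2))
  show ?thesis
    unfolding normalized_solution_def
  proof (intro conjI allI ballI)
    show "finitely_open (\<phi> ` U)" by (rule open_image)
    show "smooth_fun_on (\<phi> ` U) (coef ?G n)" for n
      unfolding coef_G by (intro smooth_compose_psi smooth_h)
    show "coef ?G 0 w = 1" if "w \<in> \<phi> ` U" for w
      using nz[of "\<psi> w"] inv_into_into[OF that] by (simp add: coef_G)
    show "evolves_by (\<phi> ` U) (normalized_A ?G) ?G"
      unfolding evolves_by_def
    proof safe
      fix i v assume i: "(1::nat) \<le> i" and v: "v \<in> U"
      define \<gamma> where "\<gamma> = coef G 0 v"
      have \<gamma>: "\<gamma> \<noteq> 0" using nz[OF v] by (simp add: \<gamma>_def)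
      define d where "d k n = partial k (coef G n) v" for k n
      define r where "r = coef G i v"
      have ev: "fls_partial i (\<lambda>w. fps_to_fls (G w)) v = bracket (schwarzian_A G i) (\<lambda>w. fps_to_fls (G w)) v"
        using S i v U(1) by (auto simp: schwarzian_solution_def evolves_by_def)
      have g0_i: "d i 0 = \<gamma> * d 0 i - d 0 0 * r"
        using schwarzian_g0_evolution[OF ev] by (simp add: d_def \<gamma>_def r_def)
      have partial_h: "partial k (?h n) v = (d k n * \<gamma> - coef G n v * d k 0) / \<gamma>\<^sup>2" for k n
        unfolding d_def \<gamma>_def
        by (intro partialI has_partial_divide smooth_fun_on_has_partial[OF smooth v] nz[OF v])
      have partial_psi: "partial k (coef ?G n) (\<phi> v) =
          (if k = 0 then partial 0 (?h n) v / p 0 v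
           else partial k (?h n) v - partial 0 (?h n) v * p k v / p 0 v)" for k n
        unfolding coef_G
        by (intro partialI has_partial_compose_psi[OF v] smooth_fun_on_has_partial[OF smooth_h]
            smooth_fun_on_imp_continuous[OF smooth_fun_on_partial[OF smooth_h]])
      have partial_0: "partial 0 (coef ?G n) (\<phi> v) = d 0 n - d 0 0 / \<gamma> * coef G n v" for n
        unfolding partial_psi partial_h p_def
        using \<gamma> by (simp add: field_simps power2_eq_square flip: \<gamma>_def)
      \<comment> \<open>Since \<open>- p i v / p 0 v = r\<close>, the time derivative at fixed
        \<open>q\<close> is \<open>\<partial>\<^sub>i + r \<partial>\<^sub>x\<close>.\<close>
      have partial_i: "partial i (coef ?G n) (\<phi> v) = 1 / \<gamma> * d i n - d i 0 / \<gamma>\<^sup>2 * coef G n v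
          + r / \<gamma> * d 0 n - r * d 0 0 / \<gamma>\<^sup>2 * coef G n v" for n
        unfolding partial_psi partial_h p_def
        using \<gamma> i by (simp add: field_simps power2_eq_square flip: \<gamma>_def r_def)
      define s where "s = fps_to_fls (G v)"
      define ds where "ds k = fps_to_fls (Abs_fps (d k))" for k
      define a where "a = lam_poly (\<lambda>k. if k < i then coef G k v else 0) i"
      define da where "da = lam_poly (\<lambda>k. if k < i then d 0 k else 0) i"
      \<comment> \<open>Constant series make the last step pure ring algebra: at \<open>v\<close>,
        \<open>u\<close> is \<open>1 / g\<^sub>0\<close>, \<open>R\<close> is
        \<open>g\<^sub>i\<close>, and \<open>P\<close>, \<open>R'\<close> are the
        \<open>x\<close>-derivatives of \<open>g\<^sub>0\<close> and
        \<open>g\<^sub>i\<close>.\<close>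
      define u P R R' where "u = fls_const (1 / \<gamma>)" and "P = fls_const (d 0 0)"
        and "R = fls_const r" and "R' = fls_const (d 0 i)"
      have "partial 0 (\<lambda>w. if k < i then coef G k w else 0) v = (if k < i then d 0 k else 0)" for k
        by (cases "k < i") (auto simp: d_def)
      with ev have s_i: "ds i = a * ds 0 - da * s"
        by (simp add: bracket_def fls_partial_fps_to_fls schwarzian_A_eq[abs_def] fls_partial_lam_poly
            ds_def s_def a_def da_def d_def[abs_def])
      \<comment> \<open>The Schwarzian \<open>A\<^sub>i\<close> lacks the constant term in
        \<open>\<lambda>\<close>; \<open>R\<close> supplies it.\<close>
      have a_R: "a + R = lam_poly (\<lambda>k. coef G k v) i"
        by (simp add: a_def R_def r_def lam_poly_last)
      have da_R: "da + R' = lam_poly (d 0) i"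
        by (simp add: da_def R'_def lam_poly_last)
      have G_hat: "fps_to_fls (?G (\<phi> v)) = u * s"
        by (simp add: psi_phi[OF v] divide_by_g0_def fls_times_fps_to_fls u_def s_def \<gamma>_def)
      have G_hat_0: "fls_partial 0 (\<lambda>w. fps_to_fls (?G w)) (\<phi> v) = ds 0 - P * u * s"
        unfolding fls_partial_fps_to_fls partial_0 ds_def s_def P_def u_def
        by (intro fls_eqI) (simp add: coef_def)
      have "fls_partial i (\<lambda>w. fps_to_fls (?G w)) (\<phi> v) = fls_const (1 / \<gamma>) * ds i - fls_const (d i 0 / \<gamma>\<^sup>2) * s
          + fls_const (r / \<gamma>) * ds 0 - fls_const (r * d 0 0 / \<gamma>\<^sup>2) * s"
        unfolding fls_partial_fps_to_fls partial_i ds_def s_def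
        by (intro fls_eqI) (simp add: coef_def)
      \<comment> \<open>Here \<open>g0_i\<close> eliminates the time derivative of
        \<open>g\<^sub>0\<close> in favour of space derivatives.\<close>
      also have "fls_const (d i 0 / \<gamma>\<^sup>2) = R' * u - P * R * u * u"
        unfolding g0_i R'_def u_def P_def R_def using \<gamma>
        by (simp add: fls_minus_const field_simps power2_eq_square)
      also have "fls_const (r / \<gamma>) = R * u" by (simp add: R_def u_def)
      also have "fls_const (r * d 0 0 / \<gamma>\<^sup>2) = R * P * u * u"
        by (simp add: R_def u_def P_def power2_eq_square)
      finally have G_hat_i: "fls_partial i (\<lambda>w. fps_to_fls (?G w)) (\<phi> v) =
          u * ds i - (R' * u - P * R * u * u) * s + R * u * ds 0 - R * P * u * u * s"
        by (simp add: u_def)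
      have "normalized_A ?G i (\<phi> v) = lam_poly (\<lambda>k. 1 / \<gamma> * coef G k v) i"
        unfolding normalized_A_eq coef_G psi_phi[OF v]
        using \<gamma> by (intro lam_poly_cong) (auto simp: \<gamma>_def)
      then have A_hat: "normalized_A ?G i (\<phi> v) = u * (a + R)"
        by (simp only: lam_poly_scale a_R u_def)
      \<comment> \<open>For \<open>k = 0\<close> the right-hand side is
        \<open>d 0 0 - d 0 0 / \<gamma> * \<gamma> = 0\<close>, the derivative of the constant 1, so
        one formula covers all \<open>k\<close>.\<close>
      have "partial 0 (\<lambda>w. if k = 0 then 1 else coef ?G k w) (\<phi> v) = d 0 k - d 0 0 / \<gamma> * coef G k v" for k
        using partial_0[of k] \<gamma> by (cases "k = 0") (auto simp: \<gamma>_def)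
      then have "fls_partial 0 (normalized_A ?G i) (\<phi> v) = lam_poly (\<lambda>k. d 0 k - d 0 0 / \<gamma> * coef G k v) i"
        unfolding normalized_A_eq[abs_def] fls_partial_lam_poly by simp
      also have "\<dots> = (da + R') - P * u * (a + R)"
        unfolding lam_poly_diff lam_poly_scale a_R da_R by (simp add: P_def u_def)
      finally have A_hat_0: "fls_partial 0 (normalized_A ?G i) (\<phi> v) = (da + R') - P * u * (a + R)" .
      \<comment> \<open>The terms containing \<open>P\<close> cancel on each side separately; what
        remains on both is \<open>u * ((a + R) * ds 0 - (da + R') * s)\<close>.\<close>
      show "fls_partial i (\<lambda>w. fps_to_fls (?G w)) (\<phi> v) =
          bracket (normalized_A ?G i) (\<lambda>w. fps_to_fls (?G w)) (\<phi> v)"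
        unfolding bracket_def G_hat G_hat_0 G_hat_i A_hat A_hat_0 s_i by algebra
    qed
  qed
qed

section \<open>Local injectivity\<close>

text \<open>Equal values at distinct points would force a zero of the derivative in between.
  \<open>min\<close> and \<open>max\<close> keep the hypothesis symmetric, so one argument handles
  both orders.\<close>

lemma has_partial_nonzero_inj_on_line:
  assumes "\<And>s. \<lbrakk>min a b \<le> s; s \<le> max a b\<rbrakk> \<Longrightarrow> \<exists>d. d \<noteq> 0 \<and> has_partial q 0 d (z(0 := s))"
    and "q (z(0 := a)) = q (z(0 := b))"
  shows "a = b"
proof -
  have *: "\<not> x < y" if "{x, y} = {a, b}" for x y
  proof
    assume "x < y"
    with that have mm: "min a b = x" "max a b = y" by (auto simp: doubleton_eq_iff)
    from assms(1)[unfolded mm] obtain d where d: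
      "\<And>s. x \<le> s \<Longrightarrow> s \<le> y \<Longrightarrow> d s \<noteq> 0 \<and> has_partial q 0 (d s) (z(0 := s))" by metis
    have "\<exists>s>x. s < y \<and> q (z(0 := y)) - q (z(0 := x)) = (y - x) * d s"
      using d by (intro MVT2[where f = "\<lambda>s. q (z(0 := s))"] \<open>x < y\<close>) (simp add: has_partial_def)
    moreover have "q (z(0 := y)) = q (z(0 := x))" using that assms(2) by (auto simp: doubleton_eq_iff)
    ultimately show False using d \<open>x < y\<close> by force
  qed
  show ?thesis using *[of a b] *[of b a] by force
qed

text \<open>On each line in direction \<open>0\<close> this is empty or an interval containing \<open>c\<close>, where Rolle applies.\<close>

definition star_part :: "point set \<Rightarrow> real \<Rightarrow> point set" where
  "star_part D c = {w. \<forall>s. min c (w 0) \<le> s \<and> s \<le> max c (w 0) \<longrightarrow> w(0 := s) \<in> D}"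

lemma star_partD:
  "w \<in> star_part D c \<Longrightarrow> min c (w 0) \<le> s \<Longrightarrow> s \<le> max c (w 0) \<Longrightarrow> w(0 := s) \<in> D"
  by (simp add: star_part_def)

text \<open>A tube lemma: the compact segment between \<open>c\<close> and \<open>z 0\<close> has a
  neighbourhood of uniform width inside \<open>D\<close>.\<close>

lemma finitely_open_star_part:
  assumes D: "finitely_open D"
  shows "finitely_open (star_part D c)"
  unfolding finitely_open_iff
proof (intro ballI allI)
  fix z N assume z: "z \<in> star_part D c"
  define l h where "l = min c (z 0)" and "h = max c (z 0)"
  \<comment> \<open>\<open>Q a b\<close> asks for one cube size valid for all \<open>s\<close> in
    \<open>[a, b]\<close>. It holds on short intervals and can be glued, as Bolzano's principle
    requires.\<close>
  define Q where "Q a b \<longleftrightarrow> (\<exists>e>0. \<forall>w\<in>box_at N e z. \<forall>s. a \<le> s \<and> s \<le> b \<longrightarrow> w(0 := s) \<in> D)" for a b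
  have local: "\<exists>d>0. Q (s - d) (s + d)" if "l \<le> s" "s \<le> h" for s
  proof -
    have "z(0 := s) \<in> D" using star_partD[OF z] that by (simp add: l_def h_def)
    then obtain e where e: "e > 0" "box_at N e (z(0 := s)) \<subseteq> D" using box_at_subset[OF D] by blast
    have "w(0 := t) \<in> D" if "w \<in> box_at N e z" "s - e / 2 \<le> t" "t \<le> s + e / 2" for w t
    proof -
      have "w(0 := t) \<in> box_at N e (z(0 := s))"
        using that e(1) box_at_near[OF that(1)] box_at_far[OF that(1)] by (intro box_atI) (auto simp: abs_less_iff)
      then show ?thesis using e(2) by blast
    qed
    then have "Q (s - e / 2) (s + e / 2)" using e(1) unfolding Q_def by blast
    then show ?thesis using e(1) by (meson half_gt_zero)
  qed
  have Q_mono: "Q a' b'" if "Q a b" "a \<le> a'" "b' \<le> b" for a b a' b'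
    using that unfolding Q_def by (meson order_trans)
  have Q_trans: "Q a b" if ab: "Q a m" "Q m b" for a m b
  proof -
    obtain e1 e2 where e: "e1 > 0" "e2 > 0"
      "\<And>w s. w \<in> box_at N e1 z \<Longrightarrow> a \<le> s \<Longrightarrow> s \<le> m \<Longrightarrow> w(0 := s) \<in> D"
      "\<And>w s. w \<in> box_at N e2 z \<Longrightarrow> m \<le> s \<Longrightarrow> s \<le> b \<Longrightarrow> w(0 := s) \<in> D"
      using ab unfolding Q_def by blast
    have "w(0 := s) \<in> D" if "w \<in> box_at N (min e1 e2) z" "a \<le> s" "s \<le> b" for w s
      using e(3,4)[of w s] box_at_mono[OF min.cobounded1 that(1)] box_at_mono[OF min.cobounded2 that(1)] that(2,3)
      by (cases "s \<le> m") auto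
    then show ?thesis unfolding Q_def using e(1,2) by (intro exI[of _ "min e1 e2"]) auto
  qed
  have "l \<le> h" by (auto simp: l_def h_def)
  then have "Q l h"
  proof (induction l h rule: Bolzano)
    case (trans a b c)
    then show ?case using Q_trans by blast
  next
    case (local x)
    then obtain d where "d > 0" "Q (x - d) (x + d)" using \<open>\<And>s. l \<le> s \<Longrightarrow> s \<le> h \<Longrightarrow> \<exists>d>0. Q (s - d) (s + d)\<close> by blast
    then show ?case by (intro exI[of _ d]) (auto intro: Q_mono)
  qed
  \<comment> \<open>\<open>z 0\<close> is an end of the segment and \<open>w 0\<close> may pass it,
    so the tube is prolonged beyond both ends.\<close>
  moreover obtain d1 where d1: "d1 > 0" "Q (l - d1) (l + d1)" using local[of l] \<open>l \<le> h\<close> by auto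
  moreover obtain d2 where d2: "d2 > 0" "Q (h - d2) (h + d2)" using local[of h] \<open>l \<le> h\<close> by auto
  moreover from d1 d2 have "Q (l - d1) l" "Q h (h + d2)" by (auto intro: Q_mono)
  ultimately have "Q (l - d1) (h + d2)" using Q_trans by blast
  then obtain e where e: "e > 0" "\<And>w s. w \<in> box_at N e z \<Longrightarrow> l - d1 \<le> s \<Longrightarrow> s \<le> h + d2 \<Longrightarrow> w(0 := s) \<in> D"
    unfolding Q_def by blast
  define \<delta> where "\<delta> = min e (min d1 d2)"
  have \<delta>: "\<delta> > 0" "\<delta> \<le> e" "\<delta> \<le> d1" "\<delta> \<le> d2" using e(1) d1(1) d2(1) by (auto simp: \<delta>_def)
  have "w \<in> star_part D c" if w: "w \<in> box_at N \<delta> z" for w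
    unfolding star_part_def
  proof (clarify)
    fix s assume s: "min c (w 0) \<le> s" "s \<le> max c (w 0)"
    have "\<bar>w 0 - z 0\<bar> < \<delta>" using box_at_near[OF w, of 0] by simp
    then have "l - d1 \<le> s" "s \<le> h + d2" using s \<delta> d1(1) d2(1) unfolding l_def h_def by linarith+
    then show "w(0 := s) \<in> D" using e(2) box_at_mono[OF \<delta>(2) w] by blast
  qed
  then show "\<exists>e>0. box_at N e z \<subseteq> star_part D c" using \<delta>(1) by blast
qed

text \<open>The witness is the star part centred at \<open>z 0\<close>. A cube would not do: it
  freezes the coordinates above \<open>N\<close> and so is not finitely open.\<close>

lemma local_injectivity:
  assumes D: "finitely_open D" and z: "z \<in> D"
    and q0: "\<And>w. w \<in> D \<Longrightarrow> \<exists>d. d \<noteq> 0 \<and> has_partial q 0 d w"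
  shows "\<exists>U. z \<in> U \<and> U \<subseteq> D \<and> finitely_open U \<and> inj_on (change_vars q) U"
proof (intro exI conjI)
  let ?U = "star_part D (z 0)"
  show "z \<in> ?U" using z by (auto simp: star_part_def)
  show "?U \<subseteq> D"
  proof
    fix w assume "w \<in> ?U"
    then show "w \<in> D" using star_partD[of w D "z 0" "w 0"] by simp
  qed
  show "finitely_open ?U" by (rule finitely_open_star_part[OF D])
  show "inj_on (change_vars q) ?U"
  proof (rule inj_onI)
    fix v w assume v: "v \<in> ?U" and w: "w \<in> ?U" and eq: "change_vars q v = change_vars q w"
    have "v k = w k" if "k \<noteq> 0" for k using fun_cong[OF eq, of k] that by (simp add: change_vars_def)
    then have w_eq: "w = v(0 := w 0)" by (auto simp: fun_eq_iff)
    have "q v = q w" using fun_cong[OF eq, of 0] by (simp add: change_vars_def)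
    then have q_eq: "q (v(0 := v 0)) = q (v(0 := w 0))" using w_eq by simp
    have "v(0 := s) \<in> D" if "min (v 0) (w 0) \<le> s" "s \<le> max (v 0) (w 0)" for s
    proof -
      have "w(0 := s) = v(0 := s)" by (subst w_eq) simp
      \<comment> \<open>The segments from \<open>z 0\<close> to \<open>v 0\<close> and to
        \<open>w 0\<close> together cover the one between \<open>v 0\<close> and
        \<open>w 0\<close>.\<close>
      moreover have "(min (z 0) (v 0) \<le> s \<and> s \<le> max (z 0) (v 0)) \<or> (min (z 0) (w 0) \<le> s \<and> s \<le> max (z 0) (w 0))"
        using that by linarith
      ultimately show ?thesis using star_partD[OF v, of s] star_partD[OF w, of s] by auto
    qed
    then have "v 0 = w 0" by (intro has_partial_nonzero_inj_on_line[OF _ q_eq] q0)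
    with w_eq show "v = w" by (metis fun_upd_triv)
  qed
qed

text \<open>Injectivity is guaranteed only locally, so the solution property is stated for every
  region of injectivity, and such regions are shown to cover \<open>D\<close>.\<close>

theorem theorem3:
  fixes G :: "point \<Rightarrow> real fps" and D :: "point set" and q :: "point \<Rightarrow> real"
  assumes "schwarzian_solution D G"
    and "\<And>z. z \<in> D \<Longrightarrow> has_partial q 0 (1 / coef G 0 z) z"
    and "\<And>i z. i \<ge> 1 \<Longrightarrow> z \<in> D \<Longrightarrow> has_partial q i (- coef G i z / coef G 0 z) z"
  shows "(\<forall>z\<in>D. \<exists>U. z \<in> U \<and> U \<subseteq> D \<and> finitely_open U \<and> inj_on (change_vars q) U) \<and>
         (\<forall>U. U \<subseteq> D \<and> finitely_open U \<and> inj_on (change_vars q) U \<longrightarrow>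
            normalized_solution (change_vars q ` U)
              (\<lambda>w. divide_by_g0 G (inv_into U (change_vars q) w)))"
proof (intro conjI ballI allI impI)
  fix z assume "z \<in> D"
  show "\<exists>U. z \<in> U \<and> U \<subseteq> D \<and> finitely_open U \<and> inj_on (change_vars q) U"
  proof (rule local_injectivity[OF _ \<open>z \<in> D\<close>])
    show "finitely_open D" using assms(1) by (simp add: schwarzian_solution_def)
    show "\<exists>d. d \<noteq> 0 \<and> has_partial q 0 d w" if "w \<in> D" for w
      using assms(1) assms(2)[OF that] that by (intro exI[of _ "1 / coef G 0 w"]) (simp add: schwarzian_solution_def)
  qed
next
  fix U assume "U \<subseteq> D \<and> finitely_open U \<and> inj_on (change_vars q) U"
  then show "normalized_solution (change_vars q ` U) (\<lambda>w. divide_by_g0 G (inv_into U (change_vars q) w))"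
    using normalized_solution_change_vars[OF assms] by blast
qed

end
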